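(* For any function $\lambda\in C[0,1]$ satisfying $$\lambda(1)=0,\qquad \lim_{r\to1}\frac{\lambda(r)}{1-r}=\infty,$$ there exists a harmonic function $u(z)$ on the unit disc $D=\{z\in\mathbb C:|z|<1\}$ with $0\le u(z)\le1$, such that $$\limsup_{r\to1}u\left(re^{i(x+\lambda(r))}\right)=1,\qquad \liminf_{r\to1}u\left(re^{i(x+\lambda(r))}\right)=0$$ at any point $x\in\mathbb T$.
   Context: $\mathbb T=\mathbb R/2\pi\mathbb Z$; $C[0,1]$ consists of real-valued continuous functions on $[0,1]$. *)

theory Defs
  imports "HOL-Analysis.Analysis"
begin

(* u is C^2 on the open set S and u_xx + u_yy = 0 there, where z = x + iy. The witnesses ux, uy,
   uxx, uxy, uyx, uyy are on S the partial derivatives of u; they are uniquely determined there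
   because S is open. Continuity of ux and uy is implied by their differentiability. *)
definition harmonic_on :: "(complex \<Rightarrow> real) \<Rightarrow> complex set \<Rightarrow> bool"  (infixl "(harmonic'_on)" 50)
  where "u harmonic_on S \<longleftrightarrow> open S \<and>
    (\<exists>ux uy uxx uxy uyx uyy :: complex \<Rightarrow> real.
      (\<forall>z\<in>S. (u has_derivative (\<lambda>h. ux z * Re h + uy z * Im h)) (at z)) \<and>
      (\<forall>z\<in>S. (ux has_derivative (\<lambda>h. uxx z * Re h + uxy z * Im h)) (at z)) \<and>
      (\<forall>z\<in>S. (uy has_derivative (\<lambda>h. uyx z * Re h + uyy z * Im h)) (at z)) \<and>
      continuous_on S uxx \<and> continuous_on S uxy \<and> continuous_on S uyx \<and> continuous_on S uyy \<and>
      (\<forall>z\<in>S. uxx z + uyy z = 0))"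

end

theory Submission
  imports Defs "HOL-Complex_Analysis.Cauchy_Integral_Formula"
begin

text \<open>
  The function is \<open>u = arg G / pi\<close> for a holomorphic map \<open>G\<close> of the disc into the upper half-plane.
  Such a \<open>u\<close> is harmonic with values in \<open>[0, 1]\<close>, and it is close to \<open>0\<close> or \<open>1\<close> where
  \<open>Re G / Im G\<close> is close to \<open>\<infinity>\<close> or \<open>-\<infinity>\<close>. Holomorphic maps into the half-plane can be added,
  which gives room for a lacunary construction
    \<open>G z = (\<Sum>k. (1/2) ^ (k + 1) * cayley (\<rho> k * z ^ N k))\<close>,
  with the Cayley transform \<open>cayley w = \<i> * (1 + w) / (1 - w)\<close> of the disc onto the half-plane.

  The Cayley transform has a pole at \<open>1\<close> and is real on the rest of the circle, so near suitable
  points of the circle it is as large as desired, of either sign and with small imaginary part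
  (\<open>cayley_near_real\<close>). The hypothesis on \<open>lam\<close> enters through
  \<open>curve_power_meets_all_directions\<close>: while the angle \<open>x + lam r\<close> sweeps a few periods of the
  \<open>N\<close>-th power, the distance \<open>1 - r\<close> is much smaller than \<open>1 / N\<close>. Hence the \<open>N\<close>-th power of
  the curve passes by every point of the circle at a small distance, whatever \<open>x\<close> is, and this
  is why the oscillation occurs for all \<open>x\<close> and not only for almost all of them.

  It remains to keep the levels from disturbing each other (\<open>level_parameters\<close>). Level \<open>k\<close> is
  bounded because \<open>\<rho> k < 1\<close>; a later level is aimed at values much larger than the sum of the
  bounds of all earlier ones. In the other direction, at the points used for level \<open>k\<close> the
  modulus is bounded by some \<open>R k < 1\<close>, and later exponents are so large that
  \<open>\<bar>z ^ N j\<bar> \<le> 1 / 2\<close> there, which bounds the later levels by a geometric series.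
  At these points the term of level \<open>k\<close> therefore determines \<open>Re G / Im G\<close>.
\<close>

section \<open>Harmonic functions from holomorphic ones\<close>

text \<open>
  By the Cauchy-Riemann equations the partial derivatives of \<open>Im h\<close> are \<open>Im h'\<close> and \<open>Re h'\<close>.
\<close>
lemma harmonic_on_Im_holomorphic:
  assumes h: "h holomorphic_on S" and S: "open S"
  shows "(\<lambda>z. Im (h z)) harmonic_on S"
proof -
  have h1: "deriv h holomorphic_on S"
    by (rule holomorphic_deriv[OF h S])
  have h2: "deriv (deriv h) holomorphic_on S"
    by (rule holomorphic_deriv[OF h1 S])
  have D0: "(h has_derivative (\<lambda>x. deriv h z * x)) (at z)" if "z \<in> S" for z
    using holomorphic_derivI[OF h S that] by (simp add: has_field_derivative_def)
  have D1: "(deriv h has_derivative (\<lambda>x. deriv (deriv h) z * x)) (at z)" if "z \<in> S" for z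
    using holomorphic_derivI[OF h1 S that] by (simp add: has_field_derivative_def)
  have cont: "continuous_on S (deriv (deriv h))"
    by (rule holomorphic_on_imp_continuous_on[OF h2])
  show ?thesis
    unfolding harmonic_on_def
  proof (intro conjI exI ballI)
    show "open S" by fact
    show "((\<lambda>z. Im (h z)) has_derivative (\<lambda>x. Im (deriv h z) * Re x + Re (deriv h z) * Im x)) (at z)"
      if "z \<in> S" for z
      using has_derivative_Im[OF D0[OF that]] by (simp add: algebra_simps)
    show "((\<lambda>z. Im (deriv h z)) has_derivative
        (\<lambda>x. Im (deriv (deriv h) z) * Re x + Re (deriv (deriv h) z) * Im x)) (at z)"
      if "z \<in> S" for z
      using has_derivative_Im[OF D1[OF that]] by (simp add: algebra_simps)
    show "((\<lambda>z. Re (deriv h z)) has_derivative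
        (\<lambda>x. Re (deriv (deriv h) z) * Re x + (- Im (deriv (deriv h) z)) * Im x)) (at z)"
      if "z \<in> S" for z
      using has_derivative_Re[OF D1[OF that]] by (simp add: algebra_simps)
  qed (auto intro!: continuous_intros cont)
qed

text \<open>
  Since \<open>arg w = pi/2 - arctan (Re w / Im w)\<close> on the upper half-plane, the size of the
  harmonic function \<open>arg G / pi\<close> is governed by the ratio \<open>Re G / Im G\<close> alone.
\<close>
lemma Im_Ln_upper_halfplane:
  assumes "0 < Im w"
  shows "Im (Ln w) = pi / 2 - arctan (Re w / Im w)"
proof -
  have "w \<noteq> 0" using assms by auto
  then have "Arg2pi w = Im (Ln w)"
    using Arg2pi_exp[of "Ln w"] Im_Ln_pos_lt_imp[OF assms] by simp
  then show ?thesis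
    using Arg2pi_arctan_upperhalf[OF assms] by simp
qed

section \<open>The Cayley transform of the disc onto the upper half-plane\<close>

definition cayley :: "complex \<Rightarrow> complex"
  where "cayley w = \<i> * (1 + w) / (1 - w)"

lemma cayley_holomorphic: "cayley holomorphic_on ball 0 1"
proof -
  have "(1::complex) \<notin> ball 0 1" by simp
  then show ?thesis
    unfolding cayley_def by (intro holomorphic_intros) auto
qed

lemma Im_cayley_pos:
  assumes "norm w < 1"
  shows "0 < Im (cayley w)"
proof -
  have w: "w \<noteq> 1" using assms by auto
  have "norm w ^ 2 < 1" using assms by (simp add: power_less_one_iff)
  then have n: "(Re w)\<^sup>2 + (Im w)\<^sup>2 < 1" by (simp add: cmod_power2)
  have p: "0 < (1 - Re w)\<^sup>2 + (Im w)\<^sup>2"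
    using w by (auto simp: complex_eq_iff sum_power2_gt_zero_iff)
  have "Im (cayley w) = (1 - ((Re w)\<^sup>2 + (Im w)\<^sup>2)) / ((1 - Re w)\<^sup>2 + (Im w)\<^sup>2)"
    unfolding cayley_def by (simp add: Im_divide) (simp add: power2_eq_square algebra_simps)
  then show ?thesis using n p by simp
qed

lemma norm_cayley_le:
  assumes "norm w \<le> b" "b < 1"
  shows "norm (cayley w) \<le> (1 + b) / (1 - b)"
proof -
  have "norm (1 + w) \<le> 1 + b" using norm_triangle_ineq[of 1 w] assms by simp
  moreover have "1 - b \<le> norm (1 - w)" using norm_triangle_ineq2[of 1 w] assms by simp
  ultimately show ?thesis
    unfolding cayley_def norm_mult norm_divide using assms order_trans[OF norm_ge_zero assms(1)]
    by (simp add: frac_le)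
qed

text \<open>
  The Cayley transform extends continuously to a map of the unit circle without \<open>1\<close> onto the
  real line, so near the boundary point over a real \<open>T\<close> its values are close to \<open>T\<close>.
\<close>
lemma cayley_near_real:
  fixes T e :: real
  assumes "0 < e"
  obtains \<theta> \<eta> where "0 < \<eta>" "\<eta> < 1"
    "\<And>s. 1 - \<eta> \<le> s \<Longrightarrow> s < 1 \<Longrightarrow> norm (cayley (of_real s * cis \<theta>) - of_real T) < e"
proof -
  \<comment> \<open>the solution of \<open>cayley w = T\<close>\<close>
  define w where "w = (of_real T - \<i>) / (of_real T + \<i>)"
  have nz: "of_real T + \<i> \<noteq> 0" by (simp add: complex_eq_iff)
  have w1: "w \<noteq> 1"
  proof
    assume "w = 1"
    then have "of_real T - \<i> = of_real T + \<i>" using nz by (simp add: w_def divide_simps)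
    then show False by (simp add: complex_eq_iff)
  qed
  have nw: "norm w = 1"
    unfolding w_def norm_divide by (simp add: cmod_def) (smt (verit) power2_less_0 real_sqrt_eq_zero_cancel_iff sum_power2_eq_zero_iff)
  then have wc: "w = cis (Arg w)"
    by (metis cis_Arg norm_eq_zero sgn_eq div_by_1 of_real_1 zero_neq_one)
  have cw: "cayley w = of_real T"
  proof -
    have a: "1 + w = 2 * of_real T / (of_real T + \<i>)" and b: "1 - w = 2 * \<i> / (of_real T + \<i>)"
      using nz by (simp_all add: w_def field_simps)
    show ?thesis unfolding cayley_def a b using nz by simp
  qed
  have "isCont cayley w"
    unfolding cayley_def using w1 by (intro continuous_intros) auto
  then have "\<forall>\<^sub>F z in at w. dist (cayley z) (cayley w) < e"
    using assms unfolding isCont_def by (rule tendstoD)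
  then obtain d where d: "d > 0" "\<And>z. z \<noteq> w \<Longrightarrow> dist z w < d \<Longrightarrow> dist (cayley z) (cayley w) < e"
    by (auto simp: eventually_at)
  show ?thesis
  proof (rule that[of "min (d / 2) (1 / 2)" "Arg w"])
    fix s :: real assume s: "1 - min (d / 2) (1 / 2) \<le> s" "s < 1"
    have "of_real s * w - w = of_real (s - 1) * w" by (simp add: algebra_simps)
    then have ds: "dist (of_real s * w) w = 1 - s"
      using s nw by (simp add: dist_norm norm_mult del: of_real_diff)
    then have "dist (cayley (of_real s * w)) (cayley w) < e"
      using s d(1) by (intro d(2)) auto
    then show "norm (cayley (of_real s * cis (Arg w)) - of_real T) < e"
      using wc cw by (simp add: dist_norm)
  qed (use d in auto)
qed

section \<open>Angles swept by the approach curve\<close>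

text \<open>
  On the way to the boundary \<open>lam\<close> takes every value in
  \<open>[2 * pi / N, 4 * pi / N]\<close>, so the \<open>N\<close>-th power of the curve makes a full turn and meets every
  direction. At these times \<open>N * lam r\<close> is bounded, and so \<open>N * (1 - r)\<close> is small because
  \<open>lam r / (1 - r)\<close> is large: the \<open>N\<close>-th power is still close to the circle. The bound
  \<open>lam r \<ge> 2 * pi / N\<close> keeps these times away from \<open>1\<close> uniformly in \<open>x\<close> and in the direction.
\<close>
lemma curve_power_meets_all_directions:
  fixes lam :: "real \<Rightarrow> real"
  assumes cont: "continuous_on {0..1} lam"
    and lam1: "lam 1 = 0"
    and lim: "filterlim (\<lambda>r. lam r / (1 - r)) at_top (at_left 1)"
    and \<eta>: "0 < \<eta>" and e: "0 < e"
  obtains N :: nat and R :: real where "N0 \<le> N" "0 < N" "0 \<le> R" "R < 1"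
    "\<And>x \<theta>. \<exists>r. 0 < r \<and> 1 - e < r \<and> r \<le> R \<and> 1 - \<eta> \<le> r ^ N \<and>
       (of_real r * exp (\<i> * of_real (x + lam r))) ^ N = of_real (r ^ N) * cis \<theta>"
proof -
  define M where "M = 4 * pi / \<eta>"
  have "\<forall>\<^sub>F r in at_left 1. max M 1 \<le> lam r / (1 - r)"
    using lim unfolding filterlim_at_top by blast
  then obtain b where b: "b < 1" "\<And>r. b < r \<Longrightarrow> r < 1 \<Longrightarrow> max M 1 \<le> lam r / (1 - r)"
    by (auto simp: eventually_at_left_field)
  \<comment> \<open>From \<open>a\<close> on, the curve is near the circle, and \<open>lam\<close> is positive and large against \<open>1 - r\<close>.\<close>
  define a where "a = (1 + Max {0, b, 1 - e}) / 2"
  have a: "0 < a" "a < 1" "b < a" "1 - e < a"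
    using b e by (auto simp: a_def field_simps max_def)
  have ba: "max M 1 \<le> lam r / (1 - r)" if "a \<le> r" "r < 1" for r
    using b(2)[of r] a that by simp
  have lama: "0 < lam a"
    using ba[of a] a by (smt (verit) divide_nonpos_pos)
  obtain N1 :: nat where N1: "4 * pi / lam a \<le> real N1"
    using real_arch_simple by blast
  define N where "N = max 1 (max N0 N1)"
  have N: "N0 \<le> N" "0 < N" "4 * pi / lam a \<le> real N"
    using N1 by (auto simp: N_def)
  have Na: "4 * pi / real N \<le> lam a"
    using N lama by (simp add: field_simps)
  have "\<exists>d>0. \<forall>r\<in>{0..1}. dist r 1 < d \<longrightarrow> dist (lam r) (lam 1) < 2 * pi / real N"
    using cont N by (auto simp: continuous_on_iff)
  then obtain d where d: "d > 0" "\<And>r. 0 \<le> r \<Longrightarrow> r \<le> 1 \<Longrightarrow> 1 - d < r \<Longrightarrow> \<bar>lam r\<bar> < 2 * pi / real N"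
    using lam1 by (auto simp: dist_real_def)
  show ?thesis
  proof (rule that[of N "max 0 (1 - d)"])
    fix x \<theta> :: real
    \<comment> \<open>The value \<open>t\<close> of \<open>lam\<close> that turns \<open>N * (x + lam r)\<close> into \<open>\<theta>\<close> modulo \<open>2 * pi\<close>;
      the integer \<open>m\<close> places it in the window of values that \<open>lam\<close> takes.\<close>
    define m where "m = \<lceil>(2 * pi - \<theta> + real N * x) / (2 * pi)\<rceil>"
    define t where "t = (\<theta> - real N * x + 2 * pi * of_int m) / real N"
    have "(2 * pi - \<theta> + real N * x) / (2 * pi) \<le> of_int m"
         "of_int m < (2 * pi - \<theta> + real N * x) / (2 * pi) + 1"
      unfolding m_def by linarith+
    then have m: "2 * pi - \<theta> + real N * x \<le> 2 * pi * of_int m"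
         "2 * pi * of_int m < 4 * pi - \<theta> + real N * x"
      by (auto simp: field_simps)
    have t: "2 * pi / real N \<le> t" "t \<le> 4 * pi / real N"
      using m N by (auto simp: t_def divide_right_mono)
    have t0: "0 < t"
      using t(1) N by (smt (verit) divide_pos_pos of_nat_0_less_iff pi_gt_zero)
    obtain r where r: "a \<le> r" "r \<le> 1" "lam r = t"
      using IVT2'[of lam 1 t a] t0 lam1 t Na a continuous_on_subset[OF cont, of "{a..1}"] by auto
    have r1: "r < 1" using r t0 lam1 by (cases "r = 1") auto
    have rd: "r \<le> 1 - d"
      using d(2)[of r] r a t t0 by force
    have "M \<le> t / (1 - r)" using ba[of r] r r1 by simp
    then have "M * (1 - r) \<le> 4 * pi / real N" using r1 t by (simp add: field_simps)
    then have "(4 * pi) * (real N * (1 - r)) \<le> (4 * pi) * \<eta>"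
      using N \<eta> by (simp add: M_def field_simps)
    then have "real N * (1 - r) \<le> \<eta>" by (subst (asm) mult_le_cancel_left_pos) auto
    moreover have "1 + real N * (r - 1) \<le> (1 + (r - 1)) ^ N"
      using r a by (intro Bernoulli_inequality) auto
    ultimately have "1 - \<eta> \<le> r ^ N" by (simp add: algebra_simps)
    moreover have "(of_real r * exp (\<i> * of_real (x + lam r))) ^ N = of_real (r ^ N) * cis \<theta>"
    proof -
      have "real N * (x + lam r) = \<theta> + 2 * pi * of_int m"
        using N by (simp add: r t_def field_simps)
      then have "cis (real N * (x + lam r)) = cis \<theta> * cis (2 * pi * of_int m)"
        by (simp only: cis_mult)
      also have "cis (2 * pi * of_int m) = 1"
        by (rule cis_multiple_2pi) simp
      finally have "cis (x + lam r) ^ N = cis \<theta>"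
        by (simp add: Complex.DeMoivre)
      then show ?thesis
        by (simp add: power_mult_distrib cis_conv_exp)
    qed
    ultimately show "\<exists>r. 0 < r \<and> 1 - e < r \<and> r \<le> max 0 (1 - d) \<and> 1 - \<eta> \<le> r ^ N \<and>
       (of_real r * exp (\<i> * of_real (x + lam r))) ^ N = of_real (r ^ N) * cis \<theta>"
      using r a rd by (intro exI[of _ r]) auto
  qed (use N d in auto)
qed

text \<open>
  One level of the construction. The factor \<open>\<rho> < 1\<close> keeps the level bounded on the whole disc,
  and it is harmless on the curve because only the product \<open>\<rho> * r ^ N\<close> has to be close to \<open>1\<close>.
\<close>
lemma curve_level:
  fixes lam :: "real \<Rightarrow> real" and K c e :: real
  assumes lam: "continuous_on {0..1} lam" "lam 1 = 0"
      "filterlim (\<lambda>r. lam r / (1 - r)) at_top (at_left 1)"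
    and c: "0 < c" and e: "0 < e"
  obtains N :: nat and \<rho> R :: real where "N0 \<le> N" "0 < N" "0 < \<rho>" "\<rho> < 1" "0 \<le> R" "R < 1"
    "\<And>x T. T \<in> {K, -K} \<Longrightarrow> \<exists>r. 0 < r \<and> 1 - e < r \<and> r \<le> R \<and>
       norm (of_real c * cayley (of_real \<rho> * (of_real r * exp (\<i> * of_real (x + lam r))) ^ N)
             - of_real T) < 1"
proof -
  have c': "0 < 1 / c" using c by simp
  obtain \<theta>1 \<eta>1 where 1: "0 < \<eta>1" "\<eta>1 < 1"
    "\<And>s. 1 - \<eta>1 \<le> s \<Longrightarrow> s < 1 \<Longrightarrow> norm (cayley (of_real s * cis \<theta>1) - of_real (K / c)) < 1 / c"
    using cayley_near_real[OF c', of "K / c"] by blast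
  obtain \<theta>2 \<eta>2 where 2: "0 < \<eta>2" "\<eta>2 < 1"
    "\<And>s. 1 - \<eta>2 \<le> s \<Longrightarrow> s < 1 \<Longrightarrow> norm (cayley (of_real s * cis \<theta>2) - of_real (- K / c)) < 1 / c"
    using cayley_near_real[OF c', of "- K / c"] by blast
  define \<eta> where "\<eta> = min \<eta>1 \<eta>2 / 2"
  have \<eta>: "0 < \<eta>" "\<eta> < 1" "2 * \<eta> \<le> \<eta>1" "2 * \<eta> \<le> \<eta>2" using 1 2 by (auto simp: \<eta>_def)
  have dir: "\<exists>\<theta>. \<forall>s. 1 - 2 * \<eta> \<le> s \<longrightarrow> s < 1 \<longrightarrow>
      norm (cayley (of_real s * cis \<theta>) - of_real (T / c)) < 1 / c" if "T \<in> {K, -K}" for T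
  proof (cases "T = K")
    case True
    then show ?thesis using 1(3) \<eta> by (intro exI[of _ \<theta>1]) auto
  next
    case False
    with that have "T = - K" by simp
    then show ?thesis using 2(3) \<eta> by (intro exI[of _ \<theta>2]) auto
  qed
  obtain N R where NR: "N0 \<le> N" "0 < N" "0 \<le> R" "R < 1"
    "\<And>x \<theta>. \<exists>r. 0 < r \<and> 1 - e < r \<and> r \<le> R \<and> 1 - \<eta> \<le> r ^ N \<and>
       (of_real r * exp (\<i> * of_real (x + lam r))) ^ N = of_real (r ^ N) * cis \<theta>"
    using curve_power_meets_all_directions[OF lam \<eta>(1) e] by metis
  show ?thesis
  proof (rule that[of N "1 - \<eta>" R])
    fix x T :: real assume "T \<in> {K, -K}"
    then obtain \<theta> where \<theta>: "\<And>s. 1 - 2 * \<eta> \<le> s \<Longrightarrow> s < 1 \<Longrightarrow>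
        norm (cayley (of_real s * cis \<theta>) - of_real (T / c)) < 1 / c"
      using dir by blast
    obtain r where r: "0 < r" "1 - e < r" "r \<le> R" "1 - \<eta> \<le> r ^ N"
      "(of_real r * exp (\<i> * of_real (x + lam r))) ^ N = of_real (r ^ N) * cis \<theta>"
      using NR(5) by blast
    define s where "s = (1 - \<eta>) * r ^ N"
    have "r ^ N \<le> 1" using r NR by (simp add: power_le_one)
    then have "s \<le> 1 - \<eta>" using \<eta> by (simp add: s_def mult_left_le)
    moreover have "(1 - \<eta>) * (1 - \<eta>) \<le> s" unfolding s_def using r \<eta> by (intro mult_left_mono) auto
    then have "1 - 2 * \<eta> \<le> s" by (simp add: algebra_simps) (smt (verit) mult_nonneg_nonneg \<eta>(1))
    ultimately have "norm (cayley (of_real s * cis \<theta>) - of_real (T / c)) < 1 / c"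
      using \<eta> by (intro \<theta>) auto
    then have "c * norm (cayley (of_real s * cis \<theta>) - of_real (T / c)) < 1"
      using c by (simp only: pos_less_divide_eq mult.commute)
    moreover have "of_real c * cayley (of_real s * cis \<theta>) - of_real T
        = of_real c * (cayley (of_real s * cis \<theta>) - of_real (T / c))"
      using c by (simp add: right_diff_distrib)
    ultimately have "norm (of_real c * cayley (of_real s * cis \<theta>) - of_real T) < 1"
      using c by (simp only: norm_mult norm_of_real abs_of_pos)
    then show "\<exists>r. 0 < r \<and> 1 - e < r \<and> r \<le> R \<and>
       norm (of_real c * cayley (of_real (1 - \<eta>) * (of_real r * exp (\<i> * of_real (x + lam r))) ^ N)
             - of_real T) < 1"
      using r by (intro exI[of _ r]) (simp add: s_def mult.assoc)
  qed (use NR \<eta> in auto)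
qed

section \<open>The sum over all levels\<close>

text \<open>
  The parameters are chosen one level after another. The constant \<open>\<Sum>j<k. 2 / (1 - \<rho> j)\<close> bounds
  the levels below \<open>k\<close> on the whole disc, so level \<open>k\<close> is made to dominate it; the condition
  \<open>R j ^ N k \<le> 1 / 2\<close> makes every later level tame at the points used for level \<open>j\<close>.
\<close>
lemma level_parameters:
  fixes lam :: "real \<Rightarrow> real"
  assumes lam: "continuous_on {0..1} lam" "lam 1 = 0"
      "filterlim (\<lambda>r. lam r / (1 - r)) at_top (at_left 1)"
  obtains N :: "nat \<Rightarrow> nat" and \<rho> R :: "nat \<Rightarrow> real"
  where "\<And>k. 0 < N k" "\<And>k. 0 < \<rho> k" "\<And>k. \<rho> k < 1" "\<And>k. 0 \<le> R k" "\<And>k. R k < 1"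
    "\<And>j k. j < k \<Longrightarrow> R j ^ N k \<le> 1 / 2"
    "\<And>k x T. \<bar>T\<bar> = (real k + 2) * ((\<Sum>j<k. 2 / (1 - \<rho> j)) + 4) \<Longrightarrow>
       \<exists>r. 0 < r \<and> 1 - 1 / (real k + 1) < r \<and> r \<le> R k \<and>
         norm (of_real ((1/2) ^ Suc k) * cayley (of_real (\<rho> k) *
             (of_real r * exp (\<i> * of_real (x + lam r))) ^ N k) - of_real T) < 1"
proof -
  \<comment> \<open>A state \<open>(B, R, N, \<rho>)\<close> records the bound \<open>B\<close> for the levels chosen so far, a radius \<open>R\<close>
    containing the points used for them, and the parameters of the newest level. The state with
    index \<open>k + 1\<close> holds level \<open>k\<close>; state \<open>0\<close> holds none.\<close>
  define P :: "nat \<Rightarrow> real \<times> real \<times> nat \<times> real \<Rightarrow> bool"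
    where "P = (\<lambda>_ (B, R, N, \<rho>). 0 \<le> R \<and> R < 1)"
  define Q :: "nat \<Rightarrow> real \<times> real \<times> nat \<times> real \<Rightarrow> real \<times> real \<times> nat \<times> real \<Rightarrow> bool"
    where "Q = (\<lambda>k (B, R, N, \<rho>) (B', R', N', \<rho>').
      B' = B + 2 / (1 - \<rho>') \<and> R \<le> R' \<and> R ^ N' \<le> 1 / 2 \<and> 0 < N' \<and> 0 < \<rho>' \<and> \<rho>' < 1 \<and>
      (\<forall>x. \<forall>T\<in>{(real k + 2) * (B + 4), - ((real k + 2) * (B + 4))}.
         \<exists>r. 0 < r \<and> 1 - 1 / (real k + 1) < r \<and> r \<le> R' \<and>
         norm (of_real ((1/2) ^ Suc k) * cayley (of_real \<rho>' *
             (of_real r * exp (\<i> * of_real (x + lam r))) ^ N') - of_real T) < 1))"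
  have step: "\<exists>s'. P (Suc k) s' \<and> Q k s s'" if "P k s" for k s
  proof -
    obtain B R N \<rho> where s: "s = (B, R, N, \<rho>)" by (cases s)
    with that have R: "0 \<le> R" "R < 1" by (auto simp: P_def)
    obtain N0 where N0: "R ^ N0 < 1 / 2"
      using real_arch_pow_inv[of "1 / 2" R] R by auto
    obtain N' \<rho>' R' where new: "N0 \<le> N'" "0 < N'" "0 < \<rho>'" "\<rho>' < 1" "0 \<le> R'" "R' < 1"
      "\<And>x T. T \<in> {(real k + 2) * (B + 4), - ((real k + 2) * (B + 4))} \<Longrightarrow>
        \<exists>r. 0 < r \<and> 1 - 1 / (real k + 1) < r \<and> r \<le> R' \<and>
         norm (of_real ((1/2) ^ Suc k) * cayley (of_real \<rho>' *
             (of_real r * exp (\<i> * of_real (x + lam r))) ^ N') - of_real T) < 1"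
      by (rule curve_level[OF lam, of "(1/2) ^ Suc k" "1 / (real k + 1)" N0
            "(real k + 2) * (B + 4)"]) (simp, simp, blast)
    have "R ^ N' \<le> R ^ N0" using R new(1) by (intro power_decreasing) auto
    with N0 have "R ^ N' \<le> 1 / 2" by simp
    moreover have "\<forall>x. \<forall>T\<in>{(real k + 2) * (B + 4), - ((real k + 2) * (B + 4))}.
         \<exists>r. 0 < r \<and> 1 - 1 / (real k + 1) < r \<and> r \<le> max R R' \<and>
         norm (of_real ((1/2) ^ Suc k) * cayley (of_real \<rho>' *
             (of_real r * exp (\<i> * of_real (x + lam r))) ^ N') - of_real T) < 1"
      using new(7) by (meson le_max_iff_disj)
    ultimately have "P (Suc k) (B + 2 / (1 - \<rho>'), max R R', N', \<rho>') \<and>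
        Q k s (B + 2 / (1 - \<rho>'), max R R', N', \<rho>')"
      unfolding P_def Q_def s prod.case using new(2-6) R by (intro conjI) auto
    then show ?thesis by blast
  qed
  have "\<exists>f. \<forall>k. (if k = 0 then f k = (0, 0, 0, 0) else P k (f k)) \<and> Q k (f k) (f (Suc k))"
  proof (rule dependent_nat_choice)
    fix s k assume "if k = 0 then s = (0, 0, 0, 0) else P k s"
    then have "P k s" by (auto simp: P_def split: if_splits)
    from step[OF this] show "\<exists>s'. (if Suc k = 0 then s' = (0, 0, 0, 0) else P (Suc k) s') \<and> Q k s s'"
      by simp
  qed auto
  then obtain f where f: "\<And>k. (if k = 0 then f k = (0, 0, 0, 0) else P k (f k)) \<and> Q k (f k) (f (Suc k))"
    by blast
  have f0: "f 0 = (0, 0, 0, 0)" using f[of 0] by simp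
  have fP: "P k (f k)" for k using f[of k] by (auto simp: P_def split: if_splits)
  have fQ: "Q k (f k) (f (Suc k))" for k using f[of k] by simp
  define B where "B k = fst (f k)" for k
  define S where "S k = fst (snd (f k))" for k
  define N where "N k = fst (snd (snd (f (Suc k))))" for k
  define \<rho> where "\<rho> k = snd (snd (snd (f (Suc k))))" for k
  have fk: "f k = (B k, S k, fst (snd (snd (f k))), snd (snd (snd (f k))))"
    and fSk: "f (Suc k) = (B (Suc k), S (Suc k), N k, \<rho> k)" for k
    by (simp_all add: B_def S_def N_def \<rho>_def)
  have S: "0 \<le> S k" "S k < 1" for k
    using fP[of k] by (subst (asm) fk, simp add: P_def)+
  have *: "B (Suc k) = B k + 2 / (1 - \<rho> k) \<and> S k \<le> S (Suc k) \<and> S k ^ N k \<le> 1 / 2 \<and> 0 < N k \<and>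
      0 < \<rho> k \<and> \<rho> k < 1 \<and>
      (\<forall>x. \<forall>T\<in>{(real k + 2) * (B k + 4), - ((real k + 2) * (B k + 4))}.
         \<exists>r. 0 < r \<and> 1 - 1 / (real k + 1) < r \<and> r \<le> S (Suc k) \<and>
         norm (of_real ((1/2) ^ Suc k) * cayley (of_real (\<rho> k) *
             (of_real r * exp (\<i> * of_real (x + lam r))) ^ N k) - of_real T) < 1)" for k
  proof -
    have "Q k (B k, S k, fst (snd (snd (f k))), snd (snd (snd (f k)))) (B (Suc k), S (Suc k), N k, \<rho> k)"
      using fQ[of k] by (simp only: fk[symmetric] fSk[symmetric])
    then show ?thesis unfolding Q_def prod.case .
  qed
  have Bk: "B k = (\<Sum>j<k. 2 / (1 - \<rho> j))" for k
    by (induction k) (use * f0 in \<open>auto simp: B_def\<close>)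
  have mono: "S i \<le> S j" if "i \<le> j" for i j
    using that by (rule lift_Suc_mono_le[rotated]) (use * in auto)
  show ?thesis
  proof (rule that[of N \<rho> "\<lambda>k. S (Suc k)"])
    fix j k :: nat assume "j < k"
    then have "S (Suc j) ^ N k \<le> S k ^ N k" using mono S by (intro power_mono) auto
    then show "S (Suc j) ^ N k \<le> 1 / 2" using *[of k] by simp
  next
    fix k :: nat and x T :: real
    assume "\<bar>T\<bar> = (real k + 2) * ((\<Sum>j<k. 2 / (1 - \<rho> j)) + 4)"
    then have "T \<in> {(real k + 2) * (B k + 4), - ((real k + 2) * (B k + 4))}"
      unfolding Bk by (auto simp: abs_if split: if_splits)
    with *[of k] show "\<exists>r. 0 < r \<and> 1 - 1 / (real k + 1) < r \<and> r \<le> S (Suc k) \<and>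
         norm (of_real ((1/2) ^ Suc k) * cayley (of_real (\<rho> k) *
             (of_real r * exp (\<i> * of_real (x + lam r))) ^ N k) - of_real T) < 1" by blast
  qed (use * S in auto)
qed

lemma norm_suminf_half_powers_le:
  fixes f :: "nat \<Rightarrow> complex"
  assumes "\<And>n. norm (f n) \<le> C * (1/2) ^ Suc n"
  shows "summable f" "norm (suminf f) \<le> C"
proof -
  have s: "(\<lambda>n. C * (1/2) ^ Suc n) sums C"
    using sums_mult[OF power_half_series, of C] by simp
  then have sm: "summable (\<lambda>n. C * (1/2) ^ Suc n)" by (rule sums_summable)
  show "summable f" by (rule summable_comparison_test'[OF sm]) (use assms in auto)
  show "norm (suminf f) \<le> C"
    using norm_suminf_le[OF assms sm] sums_unique[OF s] by simp
qed

text \<open>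
  At the point \<open>z\<close> found for level \<open>k\<close> the term of level \<open>k\<close> is within \<open>1\<close> of \<open>\<sigma> * (k + 2) * D\<close>,
  where \<open>D = (\<Sum>j<k. 2 / (1 - \<rho> j)) + 4\<close>, and all other terms together are at most \<open>D - 1\<close>.
  So \<open>G z\<close> is within \<open>D\<close> of the real number \<open>\<sigma> * (k + 2) * D\<close>: the modulus of its real part is
  at least \<open>(k + 1) * D\<close>, and its imaginary part is at most \<open>D\<close>.
\<close>
lemma halfplane_function_along_curve:
  fixes lam :: "real \<Rightarrow> real"
  assumes lam: "continuous_on {0..1} lam" "lam 1 = 0"
      "filterlim (\<lambda>r. lam r / (1 - r)) at_top (at_left 1)"
  obtains G :: "complex \<Rightarrow> complex" where "G holomorphic_on ball 0 1"
    "\<And>z. z \<in> ball 0 1 \<Longrightarrow> 0 < Im (G z)"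
    "\<And>x k \<sigma>. \<sigma> \<in> {1, -1} \<Longrightarrow> \<exists>r. 0 < r \<and> 1 - 1 / (real k + 1) < r \<and> r < 1 \<and>
       real k + 1 \<le> \<sigma> * (Re (G (of_real r * exp (\<i> * of_real (x + lam r)))) /
                          Im (G (of_real r * exp (\<i> * of_real (x + lam r)))))"
proof -
  obtain N \<rho> R where par: "\<And>k. 0 < N k" "\<And>k. 0 < \<rho> k" "\<And>k. \<rho> k < 1" "\<And>k. 0 \<le> R k" "\<And>k. R k < 1"
    and gap: "\<And>j k. j < k \<Longrightarrow> R j ^ N k \<le> 1 / 2"
    and peak: "\<And>k x T. \<bar>T\<bar> = (real k + 2) * ((\<Sum>j<k. 2 / (1 - \<rho> j)) + 4) \<Longrightarrow>
       \<exists>r. 0 < r \<and> 1 - 1 / (real k + 1) < r \<and> r \<le> R k \<and>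
         norm (of_real ((1/2) ^ Suc k) * cayley (of_real (\<rho> k) *
             (of_real r * exp (\<i> * of_real (x + lam r))) ^ N k) - of_real T) < 1"
    by (rule level_parameters[OF lam]) blast
  define g where "g k z = of_real ((1/2) ^ Suc k) * cayley (of_real (\<rho> k) * z ^ N k)" for k z
  define G where "G z = (\<Sum>k. g k z)" for z
  have arg_le: "norm (of_real (\<rho> k) * z ^ N k) \<le> norm z ^ N k" for k and z :: complex
    using par(2,3)[of k] by (simp add: norm_mult norm_power mult_left_le_one_le)
  have arg_le': "norm (of_real (\<rho> k) * z ^ N k) \<le> \<rho> k" if "norm z < 1" for k and z :: complex
    using par(2,3)[of k] that by (simp add: norm_mult norm_power mult_left_le power_le_one)
  have arg_le'': "norm (of_real (\<rho> k) * z ^ N k) \<le> norm z" if "norm z < 1" for k and z :: complex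
    using arg_le[of k z] power_decreasing[of 1 "N k" "norm z"] par(1)[of k] that by simp
  have g_le: "norm (g k z) \<le> C * (1/2) ^ Suc k" if "norm (cayley (of_real (\<rho> k) * z ^ N k)) \<le> C" for k z C
    using mult_right_mono[OF that, of "(1/2) ^ Suc k"]
    by (simp add: g_def norm_mult norm_power mult.commute del: power_Suc)
  have g_loc: "norm (g k z) \<le> (1 + b) / (1 - b) * (1/2) ^ Suc k" if "norm z \<le> b" "b < 1" for k z b
    using arg_le''[of z k] that by (intro g_le norm_cayley_le) auto
  have summ: "summable (\<lambda>k. g k z)" if "norm z < 1" for z
    by (rule norm_suminf_half_powers_le(1)[OF g_loc[OF order_refl that]])
  have g_hol: "g k holomorphic_on ball 0 1" for k
  proof -
    have "(cayley \<circ> (\<lambda>z. of_real (\<rho> k) * z ^ N k)) holomorphic_on ball 0 1"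
    proof (rule holomorphic_on_compose_gen[OF _ cayley_holomorphic])
      show "(\<lambda>z. complex_of_real (\<rho> k) * z ^ N k) ` ball 0 1 \<subseteq> ball 0 1"
      proof clarify
        fix z :: complex assume "z \<in> ball 0 1"
        then show "complex_of_real (\<rho> k) * z ^ N k \<in> ball 0 1"
          using arg_le''[of z k] by simp
      qed
    qed (intro holomorphic_intros)
    then show ?thesis unfolding g_def o_def by (intro holomorphic_intros)
  qed
  have hol: "G holomorphic_on ball 0 1"
  proof (rule holomorphic_uniform_sequence)
    show "(\<lambda>z. \<Sum>k<n. g k z) holomorphic_on ball 0 1" for n
      by (intro holomorphic_intros g_hol)
    show "\<exists>d>0. cball z d \<subseteq> ball 0 1 \<and>
        uniform_limit (cball z d) (\<lambda>n z. \<Sum>k<n. g k z) G sequentially"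
      if z: "z \<in> ball 0 1" for z
    proof (intro exI conjI)
      define d where "d = (1 - norm z) / 2"
      show "0 < d" using z by (simp add: d_def)
      have b: "norm w \<le> (1 + norm z) / 2" if "w \<in> cball z d" for w
        using that norm_triangle_sub[of w z] by (simp add: d_def dist_norm norm_minus_commute field_simps)
      have b1: "(1 + norm z) / 2 < 1" using z by simp
      show "cball z d \<subseteq> ball 0 1" using b b1 by force
      have "summable (\<lambda>k. (1 + (1 + norm z) / 2) / (1 - (1 + norm z) / 2) * (1/2) ^ Suc k)"
        using sums_summable[OF power_half_series] by (rule summable_mult)
      then show "uniform_limit (cball z d) (\<lambda>n z. \<Sum>k<n. g k z) G sequentially"
        unfolding G_def using g_loc[OF b b1] by (intro Weierstrass_m_test)
    qed
  qed simp
  have pos: "0 < Im (G z)" if z: "norm z < 1" for z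
  proof -
    have "(\<lambda>k. Im (g k z)) sums Im (G z)"
      unfolding G_def using summable_sums[OF summ[OF z]] by (rule sums_Im)
    moreover have "0 < Im (g k z)" for k
      using Im_cayley_pos[of "of_real (\<rho> k) * z ^ N k"] arg_le''[OF z, of k] z
      by (simp add: g_def)
    ultimately show ?thesis
      by (metis sums_unique sums_summable suminf_pos)
  qed
  \<comment> \<open>earlier levels contribute at most the sum of their global bounds, later ones at most \<open>3\<close>,
    since \<open>\<bar>cayley w\<bar> \<le> 3\<close> for \<open>\<bar>w\<bar> \<le> 1 / 2\<close>\<close>
  have main: "norm (G z - g k z) \<le> (\<Sum>j<k. 2 / (1 - \<rho> j)) + 3" if z: "norm z \<le> R k" for z k
  proof -
    have z1: "norm z < 1" using z par(5)[of k] by simp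
    have "G z = (\<Sum>i. g (i + Suc k) z) + (\<Sum>j<Suc k. g j z)"
      unfolding G_def by (rule suminf_split_initial_segment[OF summ[OF z1]])
    then have "G z - g k z = (\<Sum>j<k. g j z) + (\<Sum>i. g (i + Suc k) z)" by simp
    also have "norm \<dots> \<le> (\<Sum>j<k. norm (g j z)) + norm (\<Sum>i. g (i + Suc k) z)"
      by (intro order_trans[OF norm_triangle_ineq] add_right_mono norm_sum)
    also have "(\<Sum>j<k. norm (g j z)) \<le> (\<Sum>j<k. 2 / (1 - \<rho> j))"
    proof (rule sum_mono)
      fix j
      have "norm (cayley (of_real (\<rho> j) * z ^ N j)) \<le> (1 + \<rho> j) / (1 - \<rho> j)"
        by (rule norm_cayley_le[OF arg_le'[OF z1] par(3)])
      also have "\<dots> \<le> 2 / (1 - \<rho> j)" using par(3)[of j] by (simp add: divide_right_mono)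
      finally have "norm (g j z) \<le> 2 / (1 - \<rho> j) * (1/2) ^ Suc j" by (rule g_le)
      also have "\<dots> \<le> 2 / (1 - \<rho> j)"
        using par(3)[of j] by (intro mult_left_le power_le_one) auto
      finally show "norm (g j z) \<le> 2 / (1 - \<rho> j)" .
    qed
    also have "norm (\<Sum>i. g (i + Suc k) z) \<le> 3"
    proof (rule norm_suminf_half_powers_le(2))
      fix i
      have "norm (of_real (\<rho> (i + Suc k)) * z ^ N (i + Suc k)) \<le> R k ^ N (i + Suc k)"
        using arg_le[of "i + Suc k" z] power_mono[OF z norm_ge_zero, of "N (i + Suc k)"] by linarith
      also have "\<dots> \<le> 1 / 2" by (rule gap) simp
      finally have "norm (cayley (of_real (\<rho> (i + Suc k)) * z ^ N (i + Suc k))) \<le> (1 + 1/2) / (1 - 1/2)"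
        by (rule norm_cayley_le) simp
      then have "norm (g (i + Suc k) z) \<le> 3 * (1/2) ^ Suc (i + Suc k)" by (intro g_le) simp
      also have "\<dots> \<le> 3 * (1/2) ^ Suc i" by (intro mult_left_mono power_decreasing) auto
      finally show "norm (g (i + Suc k) z) \<le> 3 * (1/2) ^ Suc i" .
    qed
    finally show ?thesis by simp
  qed
  show ?thesis
  proof (rule that[of G])
    fix x \<sigma> :: real and k :: nat assume \<sigma>: "\<sigma> \<in> {1, -1}"
    define D where "D = (\<Sum>j<k. 2 / (1 - \<rho> j)) + 4"
    have "0 \<le> (\<Sum>j<k. 2 / (1 - \<rho> j))"
      using par(3) by (intro sum_nonneg) (simp add: less_imp_le)
    then have D: "0 < D" by (simp add: D_def)
    have "\<bar>\<sigma> * ((real k + 2) * D)\<bar> = (real k + 2) * D" using \<sigma> D by (auto simp: abs_mult)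
    from peak[OF this[unfolded D_def]] obtain r where r: "0 < r" "1 - 1 / (real k + 1) < r" "r \<le> R k"
      "norm (g k (of_real r * exp (\<i> * of_real (x + lam r))) - of_real (\<sigma> * ((real k + 2) * D))) < 1"
      unfolding g_def D_def by metis
    define z where "z = of_real r * exp (\<i> * of_real (x + lam r))"
    have nz: "norm z = r" using r(1) by (simp add: z_def norm_mult)
    have "norm (G z - of_real (\<sigma> * ((real k + 2) * D)))
        \<le> norm (G z - g k z) + norm (g k z - of_real (\<sigma> * ((real k + 2) * D)))"
      using norm_triangle_ineq[of "G z - g k z" "g k z - of_real (\<sigma> * ((real k + 2) * D))"] by simp
    also have "\<dots> \<le> D"
      using main[of z k] r nz unfolding z_def[symmetric] by (simp add: D_def)
    finally have near: "norm (G z - of_real (\<sigma> * ((real k + 2) * D))) \<le> D" .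
    have re: "\<bar>Re (G z) - \<sigma> * ((real k + 2) * D)\<bar> \<le> D" and im: "\<bar>Im (G z)\<bar> \<le> D"
      using abs_Re_le_cmod[of "G z - of_real (\<sigma> * ((real k + 2) * D))"]
        abs_Im_le_cmod[of "G z - of_real (\<sigma> * ((real k + 2) * D))"] near by auto
    have r1: "r < 1" using r(3) par(5)[of k] by simp
    have p: "0 < Im (G z)" using pos nz r1 by simp
    have "(real k + 1) * Im (G z) \<le> (real k + 1) * D" using im by (intro mult_left_mono) auto
    also have "\<dots> \<le> \<sigma> * Re (G z)" using \<sigma> re by (auto simp: algebra_simps)
    finally have "real k + 1 \<le> \<sigma> * (Re (G z) / Im (G z))" using p by (simp add: pos_le_divide_eq)
    then show "\<exists>r. 0 < r \<and> 1 - 1 / (real k + 1) < r \<and> r < 1 \<and>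
       real k + 1 \<le> \<sigma> * (Re (G (of_real r * exp (\<i> * of_real (x + lam r)))) /
                          Im (G (of_real r * exp (\<i> * of_real (x + lam r)))))"
      using r r1 unfolding z_def by blast
  qed (use hol pos in auto)
qed

section \<open>Upper and lower limits along the curve\<close>

lemma Limsup_at_left_eqI:
  fixes v :: "real \<Rightarrow> real"
  assumes le: "\<forall>\<^sub>F r in at_left 1. v r \<le> c"
    and a: "a \<longlonglongrightarrow> c"
    and ge: "\<And>k. \<exists>r. 1 - 1 / (real k + 1) < r \<and> r < 1 \<and> a k \<le> v r"
  shows "Limsup (at_left 1) (\<lambda>r. ereal (v r)) = ereal c"
proof (rule antisym)
  show "Limsup (at_left 1) (\<lambda>r. ereal (v r)) \<le> ereal c"
    using le by (intro Limsup_bounded) auto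
  show "ereal c \<le> Limsup (at_left 1) (\<lambda>r. ereal (v r))"
  proof (rule ccontr)
    assume "\<not> ?thesis"
    then obtain d where d: "Limsup (at_left 1) (\<lambda>r. ereal (v r)) < ereal d" "ereal d < ereal c"
      using ereal_dense2 by (metis not_le)
    from Limsup_lessD[OF d(1)] have "\<forall>\<^sub>F r in at_left 1. v r < d" by simp
    then obtain b where b: "b < 1" "\<And>r. b < r \<Longrightarrow> r < 1 \<Longrightarrow> v r < d"
      by (auto simp: eventually_at_left_field)
    have "(\<lambda>k. 1 - 1 / (real k + 1)) \<longlonglongrightarrow> 1 - 0"
      using LIMSEQ_inverse_real_of_nat by (intro tendsto_diff tendsto_const) (simp add: field_simps)
    then have "\<forall>\<^sub>F k in sequentially. b < 1 - 1 / (real k + 1)" using b(1) by (intro order_tendstoD) auto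
    moreover have "\<forall>\<^sub>F k in sequentially. d < a k" using a d(2) by (intro order_tendstoD) auto
    ultimately have "\<forall>\<^sub>F k in sequentially. False"
    proof eventually_elim
      case (elim k)
      obtain r where "1 - 1 / (real k + 1) < r" "r < 1" "a k \<le> v r" using ge by blast
      then show ?case using elim b(2)[of r] by simp
    qed
    then show False by simp
  qed
qed

lemma Liminf_at_left_eqI:
  fixes v :: "real \<Rightarrow> real"
  assumes "\<forall>\<^sub>F r in at_left 1. c \<le> v r"
    and "a \<longlonglongrightarrow> c"
    and "\<And>k. \<exists>r. 1 - 1 / (real k + 1) < r \<and> r < 1 \<and> v r \<le> a k"
  shows "Liminf (at_left 1) (\<lambda>r. ereal (v r)) = ereal c"
proof -
  have "Limsup (at_left 1) (\<lambda>r. ereal (- v r)) = ereal (- c)"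
    by (rule Limsup_at_left_eqI[where a="\<lambda>k. - a k"]) (use assms in \<open>auto intro: tendsto_minus\<close>)
  then have "- Liminf (at_left 1) (\<lambda>r. ereal (v r)) = - ereal c"
    using ereal_Limsup_uminus[of "at_left 1" "\<lambda>r. ereal (v r)"] by simp
  then show ?thesis
    by (simp only: ereal_uminus_eq_iff)
qed

theorem corollary2p1:
  fixes lam :: "real \<Rightarrow> real"
  assumes "continuous_on {0..1} lam"
    and "lam 1 = 0"
    and "filterlim (\<lambda>r. lam r / (1 - r)) at_top (at_left 1)"
  shows "\<exists>u :: complex \<Rightarrow> real.
    u harmonic_on ball 0 1 \<and>
    (\<forall>z\<in>ball 0 1. 0 \<le> u z \<and> u z \<le> 1) \<and>
    (\<forall>x :: real.
      Limsup (at_left 1) (\<lambda>r. ereal (u (of_real r * exp (\<i> * of_real (x + lam r))))) = 1 \<and>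
      Liminf (at_left 1) (\<lambda>r. ereal (u (of_real r * exp (\<i> * of_real (x + lam r))))) = 0)"
proof -
  obtain G where G: "G holomorphic_on ball 0 1" "\<And>z. z \<in> ball 0 1 \<Longrightarrow> 0 < Im (G z)"
    and osc: "\<And>x k \<sigma>. \<sigma> \<in> {1, -1} \<Longrightarrow> \<exists>r. 0 < r \<and> 1 - 1 / (real k + 1) < r \<and> r < 1 \<and>
       real k + 1 \<le> \<sigma> * (Re (G (of_real r * exp (\<i> * of_real (x + lam r)))) /
                          Im (G (of_real r * exp (\<i> * of_real (x + lam r)))))"
    by (rule halfplane_function_along_curve[OF assms]) blast
  define u where "u z = Im (Ln (G z) / of_real pi)" for z
  have u_eq: "u z = 1 / 2 - arctan (Re (G z) / Im (G z)) / pi" if "z \<in> ball 0 1" for z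
    using Im_Ln_upper_halfplane[OF G(2)[OF that]] by (simp add: u_def Im_divide_of_real diff_divide_distrib)
  have u01: "0 \<le> u z \<and> u z \<le> 1" if "z \<in> ball 0 1" for z
    using Im_Ln_pos_lt_imp[OF G(2)[OF that]] by (simp add: u_def Im_divide_of_real)
  have "(\<lambda>z. Ln (G z) / of_real pi) holomorphic_on ball 0 1"
    using G by (intro holomorphic_intros) (force simp: complex_nonpos_Reals_iff)+
  then have harm: "u harmonic_on ball 0 1"
    unfolding u_def by (rule harmonic_on_Im_holomorphic) simp
  have arctan_lim: "(\<lambda>k. arctan (real k + 1)) \<longlonglongrightarrow> pi / 2"
  proof -
    have "filterlim (\<lambda>k. real k + 1) at_top sequentially"
      using filterlim_compose[OF filterlim_real_sequentially filterlim_Suc] by (simp add: add.commute)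
    then show ?thesis by (rule filterlim_compose[OF tendsto_arctan_at_top])
  qed
  have "Limsup (at_left 1) (\<lambda>r. ereal (u (of_real r * exp (\<i> * of_real (x + lam r))))) = 1 \<and>
      Liminf (at_left 1) (\<lambda>r. ereal (u (of_real r * exp (\<i> * of_real (x + lam r))))) = 0" for x :: real
  proof -
    define \<gamma> where "\<gamma> r = complex_of_real r * exp (\<i> * of_real (x + lam r))" for r
    have \<gamma>: "\<gamma> r \<in> ball 0 1" if "0 < r" "r < 1" for r
      using that by (simp add: \<gamma>_def norm_mult)
    have ev: "\<forall>\<^sub>F r in at_left 1. \<gamma> r \<in> ball 0 1"
      using \<gamma> by (auto simp: eventually_at_left_field intro!: exI[of _ 0])
    have "Limsup (at_left 1) (\<lambda>r. ereal (u (\<gamma> r))) = ereal 1"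
    proof (rule Limsup_at_left_eqI)
      show "\<forall>\<^sub>F r in at_left 1. u (\<gamma> r) \<le> 1" using ev by eventually_elim (use u01 in auto)
      have "(\<lambda>k. 1 / 2 + arctan (real k + 1) / pi) \<longlonglongrightarrow> 1 / 2 + (pi / 2) / pi"
        by (intro tendsto_intros arctan_lim) auto
      then show "(\<lambda>k. 1 / 2 + arctan (real k + 1) / pi) \<longlonglongrightarrow> 1" by simp
      fix k
      obtain r where r: "0 < r" "1 - 1 / (real k + 1) < r" "r < 1"
        "real k + 1 \<le> - (Re (G (\<gamma> r)) / Im (G (\<gamma> r)))"
        using osc[of "-1" k x] by (auto simp: \<gamma>_def)
      then have "arctan (real k + 1) \<le> - arctan (Re (G (\<gamma> r)) / Im (G (\<gamma> r)))"
        using arctan_monotone'[OF r(4)] arctan_minus by metis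
      then have "1 / 2 + arctan (real k + 1) / pi \<le> u (\<gamma> r)"
        using u_eq[OF \<gamma>[OF r(1,3)]] by (simp add: field_simps)
      then show "\<exists>r. 1 - 1 / (real k + 1) < r \<and> r < 1 \<and> 1 / 2 + arctan (real k + 1) / pi \<le> u (\<gamma> r)"
        using r by blast
    qed
    moreover have "Liminf (at_left 1) (\<lambda>r. ereal (u (\<gamma> r))) = ereal 0"
    proof (rule Liminf_at_left_eqI)
      show "\<forall>\<^sub>F r in at_left 1. 0 \<le> u (\<gamma> r)" using ev by eventually_elim (use u01 in auto)
      have "(\<lambda>k. 1 / 2 - arctan (real k + 1) / pi) \<longlonglongrightarrow> 1 / 2 - (pi / 2) / pi"
        by (intro tendsto_intros arctan_lim) auto
      then show "(\<lambda>k. 1 / 2 - arctan (real k + 1) / pi) \<longlonglongrightarrow> 0" by simp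
      fix k
      obtain r where r: "0 < r" "1 - 1 / (real k + 1) < r" "r < 1"
        "real k + 1 \<le> Re (G (\<gamma> r)) / Im (G (\<gamma> r))"
        using osc[of 1 k x] by (auto simp: \<gamma>_def)
      have "u (\<gamma> r) \<le> 1 / 2 - arctan (real k + 1) / pi"
        using arctan_monotone'[OF r(4)] u_eq[OF \<gamma>[OF r(1,3)]] by (simp add: field_simps)
      then show "\<exists>r. 1 - 1 / (real k + 1) < r \<and> r < 1 \<and> u (\<gamma> r) \<le> 1 / 2 - arctan (real k + 1) / pi"
        using r by blast
    qed
    ultimately show ?thesis by (simp add: \<gamma>_def one_ereal_def zero_ereal_def)
  qed
  with harm u01 show ?thesis by blast
qed

end
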